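(* Let $X,Y,Z$ be $R^+$-spaces. For all $s\in P(X\multimap Y)$ and $t\in P(Y\multimap Z)$, the matrix product $t\cdot s$ is well-defined and belongs to $P(X\multimap Z)$. Moreover the identity matrix $\mathrm{id}_X\in (R^+)^{|X|\times|X|}$, $(\mathrm{id}_X)_{a,a'}=\delta_{a,a'}$, belongs to $P(X\multimap X)$. Consequently there is a category whose objects are $R^+$-spaces, whose morphisms $X\to Y$ are the elements of $P(X\multimap Y)$, and whose composition is matrix multiplication.
   Context: Partial commutative monoid (PCM): a nonempty set $M$ with a partial sum $\Sigma$ on countably indexed families (those in its domain are "summable") such that (Unary) every singleton family $(x)$ is summable with sum $x$, and (WPA) for a summable $(x_a)_{a\in A}$ and a partition $\{A_i\}_{i\in I}$ ($I$ countable, parts possibly empty), each $(x_a)_{a\in A_i}$ is summable, $(\sum_{a\in A_i}x_a)_i$ is summable and has sum $\sum_{a\in A}x_a$. It is strong if also (PA): whenever each $(x_a)_{a\in A_i}$ is summable and $(\sum_{a\in A_i}x_a)_i$ is summable, then $(x_a)_{a\in A}$ is summable. $0$ is the sum of the empty family; $x\le y$ iff $x+z=y$ for some $z$. A partial commutative rig (PCR) $(R,\Sigma,1,\cdot)$ is a PCM $(R,\Sigma)$ with a commutative monoid $(R,1,\cdot)$ such that whenever $(x_a)_{a\in A}$ and $(y_b)_{b\in B}$ are summable, $(x_ay_b)_{(a,b)\in A\times B}$ is summable with sum $(\sum_a x_a)(\sum_b y_b)$; it is strong if its PCM is strong. Standing setting: $R^+$ is a strong PCR and $\mathcal B\subseteq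 R^+$ is downward closed ($x\le y\in\mathcal B$ implies $x\in\mathcal B$). Webs are countable sets. For a web $W$, vectors are elements of $(R^+)^W$. The (partial) scalar product is $\langle x,y\rangle=\sum_{a\in W}x_ay_a$; $x\perp y$ means $\langle x,y\rangle$ is defined and lies in $\mathcal B$; for $F\subseteq (R^+)^W$, $F^\perp=\{y\mid \forall x\in F,\ x\perp y\}$. A covering is a set $F\subseteq (R^+)^W$ such that for every $a\in W$ some $x\in F$ has $x_a$ invertible in $(R^+,1,\cdot)$. An $R^+$-space is a pair $X=(|X|,P(X))$ with $|X|$ a web, $P(X)\subseteq (R^+)^{|X|}$, $P(X)^{\perp\perp}=P(X)$, and both $P(X)$ and $P(X)^\perp$ coverings; its dual is $X^\perp=(|X|,P(X)^\perp)$. For $x\in (R^+)^{|X|},y\in(R^+)^{|Y|}$, $x\otimes y\in (R^+)^{|X|\times|Y|}$ is $(x\otimes y)_{a,b}=x_ay_b$, and $F\otimes G=\{x\otimes y\mid x\in F,y\in G\}$. $X\otimes Y=(|X|\times|Y|,(P(X)\otimes P(Y))^{\perp\perp})$ and $X\multimap Y=(X\otimes Y^\perp)^\perp$. Matrix operations (partial, defined when all the component sums are defined): for $s\in (R^+)^{|X|\times|Y|}$, $t\in(R^+)^{|Y|\times|Z|}$, $(t\cdot s)_{a,c}=\sum_{b\in|Y|}s_{a,b}t_{b,c}$ and $(s\cdot x)_b=\sum_{a\in|X|}s_{a,b}x_a$. *)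

theory Defs
  imports
    "HOL-Library.FuncSet"
    "HOL-Library.Countable_Set"
    "HOL-Library.Disjoint_Sets"
    "HOL-Algebra.Group"
begin

section \<open>Partial commutative monoids\<close>

text \<open>
  A countable family over \<open>M\<close> is represented by a partial function \<open>x :: nat \<rightharpoonup> 'r\<close> whose index
  set is \<open>dom x\<close>; a partial sum is a function \<open>S\<close> from such families to \<open>'r option\<close>, with
  \<open>S x = None\<close> meaning that \<open>x\<close> is not summable. No generality is lost by taking index sets inside
  \<open>nat\<close>: the axioms Unary and WPA force invariance of sums under reindexing (a bijection is a
  partition into singletons; see \<open>fsum_reindex\<close> below), so a partial sum on all countably indexed
  families is determined by its values on these. In \<open>wpa\<close> and \<open>pa\<close> the partial function
  \<open>\<lambda>i. if i \<in> I then S (x |` A i) else None\<close> is the family of the sums of the parts, and its index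
  set is all of \<open>I\<close> exactly when every part is summable.
\<close>

locale pcm =
  fixes M :: "'r set" and S :: "(nat \<rightharpoonup> 'r) \<Rightarrow> 'r option"
  assumes nonempty: "M \<noteq> {}"
    and sum_in: "S x = Some v \<Longrightarrow> ran x \<subseteq> M \<and> v \<in> M"
    and unary: "v \<in> M \<Longrightarrow> S [i \<mapsto> v] = Some v"
    and wpa: "\<lbrakk>S x = Some v; disjoint_family_on A I; (\<Union>i\<in>I. A i) = dom x\<rbrakk> \<Longrightarrow>
      (\<forall>i\<in>I. S (x |` A i) \<noteq> None) \<and>
      S (\<lambda>i. if i \<in> I then S (x |` A i) else None) = Some v"

locale strong_pcm = pcm +
  assumes pa: "\<lbrakk>disjoint_family_on A I; (\<Union>i\<in>I. A i) = dom x;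
      \<forall>i\<in>I. S (x |` A i) \<noteq> None;
      S (\<lambda>i. if i \<in> I then S (x |` A i) else None) \<noteq> None\<rbrakk> \<Longrightarrow> S x \<noteq> None"

text \<open>
  The sum of a family \<open>(x a)\<close> with \<open>a\<close> in a countable set \<open>A\<close> of any type, through an enumeration
  of \<open>A\<close>. The choice of the enumeration is immaterial (\<open>fsum_reindex\<close>, \<open>fsum_nat\<close>).
\<close>

definition fsum :: "((nat \<rightharpoonup> 'r) \<Rightarrow> 'r option) \<Rightarrow> 'i set \<Rightarrow> ('i \<Rightarrow> 'r) \<Rightarrow> 'r option" where
  "fsum S A x =
    (if countable A
     then S (\<lambda>n. if n \<in> to_nat_on A ` A then Some (x (from_nat_into A n)) else None)
     else None)"

context pcm
begin

lemma sum_reindex_Some: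
  assumes "S (\<lambda>n. if n \<in> A then Some (x n) else None) = Some v" and f: "bij_betw f B A"
  shows "S (\<lambda>n. if n \<in> B then Some (x (f n)) else None) = Some v"
proof -
  let ?x = "\<lambda>n. if n \<in> A then Some (x n) else None"
  have dom: "dom ?x = A" by (auto simp: dom_def split: if_splits)
  have inj: "inj_on f B" and im: "f ` B = A" using f by (auto simp: bij_betw_def)
  have disj: "disjoint_family_on (\<lambda>i. {f i}) B"
    using inj by (auto simp: disjoint_family_on_def inj_on_def)
  have cov: "(\<Union>i\<in>B. {f i}) = dom ?x" using im dom by auto
  have ran: "x a \<in> M" if "a \<in> A" for a
    using sum_in[OF assms(1)] that by (auto simp: ran_def split: if_splits)
  have single: "S (?x |` {f i}) = Some (x (f i))" if "i \<in> B" for i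
  proof -
    have "f i \<in> A" using im that by auto
    moreover from this have "?x |` {f i} = [f i \<mapsto> x (f i)]"
      by (auto simp: restrict_map_def fun_eq_iff)
    ultimately show ?thesis using unary[OF ran] that by simp
  qed
  have "(\<lambda>i. if i \<in> B then S (?x |` {f i}) else None) =
        (\<lambda>n. if n \<in> B then Some (x (f n)) else None)"
    by (rule ext) (simp add: single)
  with wpa[OF assms(1) disj cov] show ?thesis by simp
qed

lemma sum_reindex:
  assumes f: "bij_betw f B A"
  shows "S (\<lambda>n. if n \<in> B then Some (x (f n)) else None) =
         S (\<lambda>n. if n \<in> A then Some (x n) else None)" (is "S ?l = S ?r")
proof -
  let ?g = "inv_into B f"
  have g: "bij_betw ?g A B" using f by (rule bij_betw_inv_into)
  have eq: "(\<lambda>n. if n \<in> A then Some (x (f (?g n))) else None) = ?r"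
    using f by (auto simp: fun_eq_iff bij_betw_inv_into_right)
  have "S ?r = Some v" if "S ?l = Some v" for v
    using sum_reindex_Some[of B "\<lambda>n. x (f n)" v ?g A, OF that g] eq by simp
  moreover have "S ?l = Some v" if "S ?r = Some v" for v
    using sum_reindex_Some[OF that f] .
  ultimately show ?thesis by (cases "S ?l"; cases "S ?r") simp_all
qed

lemma fsum_nat: "fsum S A x = S (\<lambda>n. if n \<in> A then Some (x n) else None)"
proof -
  have "bij_betw (from_nat_into A) (to_nat_on A ` A) A"
    by (rule bij_betw_byWitness[where f' = "to_nat_on A"]) auto
  from sum_reindex[OF this] show ?thesis by (simp add: fsum_def)
qed

lemma fsum_reindex:
  assumes "countable A" and f: "bij_betw f A B"
  shows "fsum S A (\<lambda>a. y (f a)) = fsum S B y"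
proof -
  have cB: "countable B" using countable_image[OF assms(1), of f] f by (simp add: bij_betw_def)
  let ?h = "\<lambda>n. to_nat_on B (f (from_nat_into A n))"
  have "bij_betw (from_nat_into A) (to_nat_on A ` A) A"
    by (rule bij_betw_byWitness[where f' = "to_nat_on A"]) (use assms in auto)
  moreover have "bij_betw (to_nat_on B) B (to_nat_on B ` B)"
    using cB by (simp add: bij_betw_def inj_on_to_nat_on)
  ultimately have h: "bij_betw ?h (to_nat_on A ` A) (to_nat_on B ` B)"
    using bij_betw_trans[OF bij_betw_trans[OF _ f]] by (simp add: comp_def)
  have inB: "f (from_nat_into A n) \<in> B" if "n \<in> to_nat_on A ` A" for n
    using that assms by (auto simp: bij_betw_def)
  have "(\<lambda>n. if n \<in> to_nat_on A ` A then Some (y (f (from_nat_into A n))) else None) =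
        (\<lambda>n. if n \<in> to_nat_on A ` A then Some (y (from_nat_into B (?h n))) else None)"
    using inB cB by (auto simp: fun_eq_iff)
  with sum_reindex[OF h, of "\<lambda>n. y (from_nat_into B n)"] assms(1) cB
  show ?thesis by (simp add: fsum_def)
qed

end


section \<open>Partial commutative rigs\<close>

record 'r pcr = "'r monoid" +
  psum :: "(nat \<rightharpoonup> 'r) \<Rightarrow> 'r option"

abbreviation rsum :: "('r, 'z) pcr_scheme \<Rightarrow> 'i set \<Rightarrow> ('i \<Rightarrow> 'r) \<Rightarrow> 'r option" where
  "rsum R \<equiv> fsum (psum R)"

locale pcr = comm_monoid R + pcm "carrier R" "psum R"
  for R :: "('r, 'z) pcr_scheme" (structure) +
  assumes sum_mult: "\<lbrakk>rsum R A x = Some u; rsum R B y = Some v\<rbrakk> \<Longrightarrow>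
    rsum R ((A :: nat set) \<times> (B :: nat set)) (\<lambda>(a, b). x a \<otimes> y b) = Some (u \<otimes> v)"

locale strong_pcr = pcr R + strong_pcm "carrier R" "psum R"
  for R :: "('r, 'z) pcr_scheme" (structure)

definition pzero :: "('r, 'z) pcr_scheme \<Rightarrow> 'r" where
  "pzero R = the (psum R Map.empty)"

definition ple :: "('r, 'z) pcr_scheme \<Rightarrow> 'r \<Rightarrow> 'r \<Rightarrow> bool" where
  "ple R x y \<longleftrightarrow> (\<exists>z. psum R [0 \<mapsto> x, 1 \<mapsto> z] = Some y)"

definition downward_closed :: "('r, 'z) pcr_scheme \<Rightarrow> 'r set \<Rightarrow> bool" where
  "downward_closed R B \<longleftrightarrow> (\<forall>x y. ple R x y \<longrightarrow> y \<in> B \<longrightarrow> x \<in> B)"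


section \<open>Vectors, orthogonality and spaces\<close>

text \<open>
  Vectors over a web \<open>W\<close> are extensional functions, so that equality of vectors is equality on \<open>W\<close>.
\<close>

abbreviation vectors :: "('r, 'z) pcr_scheme \<Rightarrow> 'a set \<Rightarrow> ('a \<Rightarrow> 'r) set" where
  "vectors R W \<equiv> W \<rightarrow>\<^sub>E carrier R"

definition sprod :: "('r, 'z) pcr_scheme \<Rightarrow> 'a set \<Rightarrow> ('a \<Rightarrow> 'r) \<Rightarrow> ('a \<Rightarrow> 'r) \<Rightarrow> 'r option" where
  "sprod R W x y = rsum R W (\<lambda>a. x a \<otimes>\<^bsub>R\<^esub> y a)"

definition orth ::
  "('r, 'z) pcr_scheme \<Rightarrow> 'r set \<Rightarrow> 'a set \<Rightarrow> ('a \<Rightarrow> 'r) \<Rightarrow> ('a \<Rightarrow> 'r) \<Rightarrow> bool" where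
  "orth R B W x y \<longleftrightarrow> (\<exists>v\<in>B. sprod R W x y = Some v)"

definition perp ::
  "('r, 'z) pcr_scheme \<Rightarrow> 'r set \<Rightarrow> 'a set \<Rightarrow> ('a \<Rightarrow> 'r) set \<Rightarrow> ('a \<Rightarrow> 'r) set" where
  "perp R B W F = {y \<in> vectors R W. \<forall>x\<in>F. orth R B W x y}"

definition covering :: "('r, 'z) pcr_scheme \<Rightarrow> 'a set \<Rightarrow> ('a \<Rightarrow> 'r) set \<Rightarrow> bool" where
  "covering R W F \<longleftrightarrow> F \<subseteq> vectors R W \<and> (\<forall>a\<in>W. \<exists>x\<in>F. x a \<in> Units R)"

record ('a, 'r) space =
  web :: "'a set"
  vecs :: "('a \<Rightarrow> 'r) set"

definition is_space :: "('r, 'z) pcr_scheme \<Rightarrow> 'r set \<Rightarrow> ('a, 'r) space \<Rightarrow> bool" where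
  "is_space R B X \<longleftrightarrow>
    countable (web X) \<and>
    vecs X \<subseteq> vectors R (web X) \<and>
    perp R B (web X) (perp R B (web X) (vecs X)) = vecs X \<and>
    covering R (web X) (vecs X) \<and>
    covering R (web X) (perp R B (web X) (vecs X))"

definition dual :: "('r, 'z) pcr_scheme \<Rightarrow> 'r set \<Rightarrow> ('a, 'r) space \<Rightarrow> ('a, 'r) space" where
  "dual R B X = \<lparr>web = web X, vecs = perp R B (web X) (vecs X)\<rparr>"

definition tensor_vec ::
  "('r, 'z) pcr_scheme \<Rightarrow> 'a set \<Rightarrow> 'b set \<Rightarrow> ('a \<Rightarrow> 'r) \<Rightarrow> ('b \<Rightarrow> 'r) \<Rightarrow> ('a \<times> 'b \<Rightarrow> 'r)" where
  "tensor_vec R W V x y = restrict (\<lambda>(a, b). x a \<otimes>\<^bsub>R\<^esub> y b) (W \<times> V)"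

definition tensor ::
  "('r, 'z) pcr_scheme \<Rightarrow> 'r set \<Rightarrow> ('a, 'r) space \<Rightarrow> ('b, 'r) space \<Rightarrow> ('a \<times> 'b, 'r) space" where
  "tensor R B X Y =
    (let W = web X \<times> web Y;
         F = {tensor_vec R (web X) (web Y) x y | x y. x \<in> vecs X \<and> y \<in> vecs Y}
     in \<lparr>web = W, vecs = perp R B W (perp R B W F)\<rparr>)"

definition lolli ::
  "('r, 'z) pcr_scheme \<Rightarrow> 'r set \<Rightarrow> ('a, 'r) space \<Rightarrow> ('b, 'r) space \<Rightarrow> ('a \<times> 'b, 'r) space" where
  "lolli R B X Y = dual R B (tensor R B X (dual R B Y))"


section \<open>Matrices and categories\<close>

definition mat_mult ::
  "('r, 'z) pcr_scheme \<Rightarrow> 'a set \<Rightarrow> 'b set \<Rightarrow> 'c set \<Rightarrow>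
    ('b \<times> 'c \<Rightarrow> 'r) \<Rightarrow> ('a \<times> 'b \<Rightarrow> 'r) \<Rightarrow> ('a \<times> 'c \<Rightarrow> 'r) option" where
  "mat_mult R W V U t s =
    (let entry = (\<lambda>(a, c). rsum R V (\<lambda>b. s (a, b) \<otimes>\<^bsub>R\<^esub> t (b, c)))
     in if \<forall>p \<in> W \<times> U. entry p \<noteq> None
        then Some (restrict (\<lambda>p. the (entry p)) (W \<times> U))
        else None)"

definition id_mat :: "('r, 'z) pcr_scheme \<Rightarrow> 'a set \<Rightarrow> ('a \<times> 'a \<Rightarrow> 'r)" where
  "id_mat R W = restrict (\<lambda>(a, a'). if a = a' then \<one>\<^bsub>R\<^esub> else pzero R) (W \<times> W)"

text \<open>
  Categories given by a family of hom-sets, which need not be disjoint;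
  \<open>Comp X Y Z g f\<close> is the composite of \<open>f : X \<rightarrow> Y\<close> and \<open>g : Y \<rightarrow> Z\<close>.
\<close>

locale category =
  fixes Obj :: "'o set"
    and Hom :: "'o \<Rightarrow> 'o \<Rightarrow> 'm set"
    and Id :: "'o \<Rightarrow> 'm"
    and Comp :: "'o \<Rightarrow> 'o \<Rightarrow> 'o \<Rightarrow> 'm \<Rightarrow> 'm \<Rightarrow> 'm"
  assumes Id_in: "X \<in> Obj \<Longrightarrow> Id X \<in> Hom X X"
    and Comp_in: "\<lbrakk>X \<in> Obj; Y \<in> Obj; Z \<in> Obj; f \<in> Hom X Y; g \<in> Hom Y Z\<rbrakk> \<Longrightarrow>
      Comp X Y Z g f \<in> Hom X Z"
    and Comp_Id: "\<lbrakk>X \<in> Obj; Y \<in> Obj; f \<in> Hom X Y\<rbrakk> \<Longrightarrow> Comp X X Y f (Id X) = f"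
    and Id_Comp: "\<lbrakk>X \<in> Obj; Y \<in> Obj; f \<in> Hom X Y\<rbrakk> \<Longrightarrow> Comp X Y Y (Id Y) f = f"
    and Comp_assoc: "\<lbrakk>W \<in> Obj; X \<in> Obj; Y \<in> Obj; Z \<in> Obj;
      f \<in> Hom W X; g \<in> Hom X Y; h \<in> Hom Y Z\<rbrakk> \<Longrightarrow>
      Comp W Y Z h (Comp W X Y g f) = Comp W X Z (Comp X Y Z h g) f"

end

theory Submission imports Defs begin

text \<open>
  A matrix \<open>s\<close> lies in \<open>P(X \<multimap> Y)\<close> iff the double sum of \<open>x\<^sub>a y\<^sub>b s\<^sub>a\<^sub>b\<close> is defined and lies in \<open>B\<close>
  for all \<open>x \<in> P(X)\<close> and \<open>y \<in> P(Y)\<^sup>\<bottom>\<close>. Coverings provide vectors with an invertible entry at a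
  prescribed place, so scalar factors can be cancelled from summable subfamilies of such double
  sums. This shows first that \<open>s \<cdot> x\<close> is defined and lies in \<open>P(Y)\<^sup>\<bottom>\<^sup>\<bottom> = P(Y)\<close>. Applying this twice,
  the iterated sum of \<open>x\<^sub>a s\<^sub>a\<^sub>b t\<^sub>b\<^sub>c z\<^sub>c\<close> is defined; by (PA) the triple family is summable, and
  cancelling \<open>x\<^sub>a\<close> and \<open>z\<^sub>c\<close> in its subfamilies shows that the entries of \<open>t \<cdot> s\<close> are defined.
\<close>

section \<open>Sums over countable sets\<close>

lemma bij_betw_swap: "bij_betw prod.swap (A \<times> B) (B \<times> A)"
  by (auto simp: bij_betw_def)

context pcm
begin

lemma fsum_cong:
  assumes "\<And>a. a \<in> A \<Longrightarrow> f a = g a"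
  shows "fsum S A f = fsum S A g"
proof (cases "countable A")
  case True
  have "f (from_nat_into A n) = g (from_nat_into A n)" if "n \<in> to_nat_on A ` A" for n
    using that True assms by auto
  then have "(\<lambda>n. if n \<in> to_nat_on A ` A then Some (f (from_nat_into A n)) else None) =
      (\<lambda>n. if n \<in> to_nat_on A ` A then Some (g (from_nat_into A n)) else None)"
    by auto
  then show ?thesis by (simp add: fsum_def)
qed (simp add: fsum_def)

lemma fsum_countable: "fsum S A f = Some v \<Longrightarrow> countable A"
  by (simp add: fsum_def split: if_splits)

lemma fsum_closed: "fsum S A f = Some v \<Longrightarrow> v \<in> M"
  using sum_in by (auto simp: fsum_def split: if_splits)

lemma fsum_singleton:
  assumes "f a \<in> M"
  shows "fsum S {a} f = Some (f a)"
proof -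
  have "fsum S {0::nat} (\<lambda>_. f a) = fsum S {a} f"
    using fsum_reindex[where A = "{0::nat}" and f = "\<lambda>_. a" and y = f and B = "{a}"]
    by (simp add: bij_betw_def)
  moreover have "fsum S {0::nat} (\<lambda>_. f a) = S [0 \<mapsto> f a]"
    by (simp add: fsum_nat) (rule arg_cong[where f = S], auto simp: fun_eq_iff)
  ultimately show ?thesis using unary[OF assms] by simp
qed

text \<open>
  The family indexed by \<open>Sigma I A\<close>, together with its partition into the fibres, transported to
  families indexed by sets of natural numbers, to which the axioms apply.
\<close>

lemma Sigma_family:
  assumes I: "countable I" and A: "\<And>i. i \<in> I \<Longrightarrow> countable (A i)"
  obtains A' :: "nat \<Rightarrow> nat set" and J :: "nat set" and x :: "nat \<rightharpoonup> 'r"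
  where "disjoint_family_on A' J" "(\<Union>j\<in>J. A' j) = dom x"
    and "fsum S (Sigma I A) f = S x"
    and "J = to_nat_on I ` I"
    and "\<forall>j\<in>J.
      S (x |` A' j) = fsum S (A (from_nat_into I j)) (\<lambda>a. f (from_nat_into I j, a))"
proof -
  define W where "W = Sigma I A"
  define e where "e = to_nat_on W"
  define J where "J = to_nat_on I ` I"
  define x where "x = (\<lambda>n. if n \<in> e ` W then Some (f (from_nat_into W n)) else None)"
  \<comment> \<open>\<open>A' j\<close> is the fibre over the element with code \<open>j\<close>, as
    a set of codes of pairs. It carries the first component along, so fibres over different elements
    stay disjoint even when the sets \<open>A i\<close> overlap.\<close>
  define A' where "A' j = e ` ({from_nat_into I j} \<times> A (from_nat_into I j))" for j
  have W: "countable W" unfolding W_def using I A by (intro countable_SIGMA)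
  have inj: "inj_on e W" unfolding e_def using W by (rule inj_on_to_nat_on)
  have J: "from_nat_into I j \<in> I" if "j \<in> J" for j using that I by (auto simp: J_def)
  have injJ: "j = k" if "j \<in> J" "k \<in> J" "from_nat_into I j = from_nat_into I k" for j k
    using that I by (auto simp: J_def)
  have sub: "{from_nat_into I j} \<times> A (from_nat_into I j) \<subseteq> W" if "j \<in> J" for j
    using J[OF that] by (auto simp: W_def)
  have "disjoint_family_on A' J"
    unfolding disjoint_family_on_def
  proof (intro ballI impI)
    fix j k assume jk: "j \<in> J" "k \<in> J" "j \<noteq> k"
    then have "({from_nat_into I j} \<times> A (from_nat_into I j)) \<inter>
        ({from_nat_into I k} \<times> A (from_nat_into I k)) = {}"
      using injJ by auto
    then show "A' j \<inter> A' k = {}"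
      unfolding A'_def using inj_on_image_Int[OF inj sub sub] jk by (metis image_empty)
  qed
  moreover have "(\<Union>j\<in>J. A' j) = dom x"
  proof -
    have "(\<Union>j\<in>J. {from_nat_into I j} \<times> A (from_nat_into I j)) = W"
      using I by (auto simp: J_def W_def)
    then have "(\<Union>j\<in>J. A' j) = e ` W" unfolding A'_def by blast
    then show ?thesis by (auto simp: x_def dom_def)
  qed
  moreover have "fsum S (Sigma I A) f = S x"
    using W by (simp add: fsum_def x_def e_def W_def[symmetric])
  moreover note J_def
  moreover have "\<forall>j\<in>J.
      S (x |` A' j) = fsum S (A (from_nat_into I j)) (\<lambda>a. f (from_nat_into I j, a))"
  proof
    fix j assume j: "j \<in> J"
    let ?i = "from_nat_into I j"
    have "A' j \<subseteq> e ` W" unfolding A'_def using sub[OF j] by blast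
    then have "x |` A' j = (\<lambda>n. if n \<in> A' j then Some (f (from_nat_into W n)) else None)"
      by (auto simp: x_def restrict_map_def fun_eq_iff)
    then have "S (x |` A' j) = fsum S (A' j) (\<lambda>n. f (from_nat_into W n))"
      by (simp add: fsum_nat)
    also have "\<dots> = fsum S (A ?i) (\<lambda>a. f (from_nat_into W (e (?i, a))))"
    proof (rule fsum_reindex[symmetric])
      show "countable (A ?i)" using A J[OF j] .
      show "bij_betw (\<lambda>a. e (?i, a)) (A ?i) (A' j)"
        unfolding bij_betw_def
      proof
        show "inj_on (\<lambda>a. e (?i, a)) (A ?i)"
          using inj sub[OF j] by (auto simp: inj_on_def)
        show "(\<lambda>a. e (?i, a)) ` A ?i = A' j"
          by (auto simp: A'_def)
      qed
    qed
    also have "\<dots> = fsum S (A ?i) (\<lambda>a. f (?i, a))"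
      using W sub[OF j] by (intro fsum_cong) (auto simp: e_def)
    finally show "S (x |` A' j) = fsum S (A ?i) (\<lambda>a. f (?i, a))" .
  qed
  ultimately show thesis by (rule that)
qed

text \<open>This is WPA for the partition into fibres: one sum over pairs splits into an iterated
  sum. Preceded by a swap of the components, it splits a double sum in the other order.\<close>

lemma fsum_SigmaD:
  assumes I: "countable I" and A: "\<And>i. i \<in> I \<Longrightarrow> countable (A i)"
    and sum: "fsum S (Sigma I A) f = Some v"
  obtains g where "\<And>i. i \<in> I \<Longrightarrow> fsum S (A i) (\<lambda>a. f (i, a)) = Some (g i)"
    and "fsum S I g = Some v"
proof -
  define g where "g i = the (fsum S (A i) (\<lambda>a. f (i, a)))" for i
  obtain A' J x where fam: "disjoint_family_on A' J" "(\<Union>j\<in>J. A' j) = dom x"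
    "fsum S (Sigma I A) f = S x" "J = to_nat_on I ` I"
    "\<forall>j\<in>J.
      S (x |` A' j) = fsum S (A (from_nat_into I j)) (\<lambda>a. f (from_nat_into I j, a))"
    by (rule Sigma_family[OF I A, where f = f])
  have def_parts: "\<forall>j\<in>J. S (x |` A' j) \<noteq> None"
    and total: "S (\<lambda>j. if j \<in> J then S (x |` A' j) else None) = Some v"
    using wpa[OF _ fam(1,2)] sum fam(3) by auto
  have g: "fsum S (A i) (\<lambda>a. f (i, a)) = Some (g i)" if "i \<in> I" for i
  proof -
    have "to_nat_on I i \<in> J" using that fam(4) by auto
    with bspec[OF def_parts this] bspec[OF fam(5) this] that I
    show ?thesis by (auto simp: g_def)
  qed
  have "(\<lambda>j. if j \<in> J then S (x |` A' j) else None) =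
      (\<lambda>j. if j \<in> J then Some (g (from_nat_into I j)) else None)"
    using fam(4,5) g I by (auto simp: fun_eq_iff)
  with total have "fsum S I g = Some v" using I fam(4) by (simp add: fsum_def)
  with g show thesis by (rule that)
qed

text \<open>A one-element family is partitioned along \<open>A\<close>, with every part empty except
  the one at \<open>a\<close>. The empty parts have sum zero, so WPA states exactly that padding
  with zeros preserves the sum.\<close>

lemma fsum_delta:
  assumes A: "countable A" "a \<in> A" and v: "v \<in> M"
  shows "fsum S A (\<lambda>b. if b = a then v else the (S Map.empty)) = Some v"
proof -
  let ?F = "\<lambda>b. if b = a then {a} else {}"
  have "Sigma A ?F = {(a, a)}" using A(2) by (auto split: if_splits)
  then have total: "fsum S (Sigma A ?F) (\<lambda>_. v) = Some v"
    using fsum_singleton[of "\<lambda>_. v" "(a, a)"] v by simp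
  obtain g where g: "\<And>b. b \<in> A \<Longrightarrow> fsum S (?F b) (\<lambda>_. v) = Some (g b)"
    and sum: "fsum S A g = Some v"
    by (rule fsum_SigmaD[OF A(1) _ total]) auto
  have "g b = (if b = a then v else the (S Map.empty))" if "b \<in> A" for b
  proof (cases "b = a")
    case True
    with g[OF that] fsum_singleton[of "\<lambda>_. v" a] v show ?thesis by simp
  next
    case False
    with g[OF that] show ?thesis by (simp add: fsum_def)
  qed
  then have "fsum S A g = fsum S A (\<lambda>b. if b = a then v else the (S Map.empty))"
    by (rule fsum_cong)
  with sum show ?thesis by simp
qed

text \<open>The axioms do not mention zero; it arises because the empty family can be a part of a
  partition of a summable family.\<close>

lemma sum_empty: "\<exists>z\<in>M. S Map.empty = Some z"
proof -
  obtain v where "v \<in> M" using nonempty by blast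
  then have "S [0 \<mapsto> v] = Some v" by (rule unary)
  \<comment> \<open>The part at index 1 is empty, so WPA makes the empty family summable.\<close>
  from wpa[OF this, of "\<lambda>i. if i = 0 then {0} else {}" "{0, 1}"]
  have "S Map.empty \<noteq> None" by (auto simp: disjoint_family_on_def)
  then show ?thesis using sum_in by fastforce
qed

end

text \<open>The converse of \<open>fsum_SigmaD\<close> is where strength enters: PA makes the joint
  family summable, and WPA then identifies its sum with the iterated one.\<close>

lemma (in strong_pcm) fsum_SigmaI:
  assumes I: "countable I"
    and g: "\<And>i. i \<in> I \<Longrightarrow> fsum S (A i) (\<lambda>a. f (i, a)) = Some (g i)"
    and sum: "fsum S I g = Some v"
  shows "fsum S (Sigma I A) f = Some v"
proof -
  have A: "countable (A i)" if "i \<in> I" for i using g[OF that] by (rule fsum_countable)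
  obtain A' J x where fam: "disjoint_family_on A' J" "(\<Union>j\<in>J. A' j) = dom x"
    "fsum S (Sigma I A) f = S x" "J = to_nat_on I ` I"
    "\<forall>j\<in>J.
      S (x |` A' j) = fsum S (A (from_nat_into I j)) (\<lambda>a. f (from_nat_into I j, a))"
    by (rule Sigma_family[OF I A, where f = f])
  have "(\<lambda>j. if j \<in> J then S (x |` A' j) else None) =
      (\<lambda>j. if j \<in> J then Some (g (from_nat_into I j)) else None)"
    using fam(4,5) g I by (auto simp: fun_eq_iff)
  then have total: "S (\<lambda>j. if j \<in> J then S (x |` A' j) else None) = Some v"
    using sum I fam(4) by (simp add: fsum_def)
  have "\<forall>j\<in>J. S (x |` A' j) \<noteq> None" using fam(4,5) g I by auto
  then have "S x \<noteq> None" using pa[OF fam(1,2)] total by auto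
  then obtain w where w: "S x = Some w" by auto
  with wpa[OF w fam(1,2)] total fam(3) show ?thesis by simp
qed

section \<open>Scaling, cancellation, zero and biorthogonality in a partial commutative rig\<close>

context pcr
begin

text \<open>Scaling is distributivity against a one-element family. Since \<open>sum_mult\<close>
  speaks of index sets in \<open>nat\<close>, the family is first moved to the codes of
  \<open>A\<close>, and the product is moved back along
  \<open>a \<mapsto> (0, to_nat_on A a)\<close>.\<close>

lemma rsum_cmult:
  assumes u: "u \<in> carrier R" and f: "rsum R A f = Some v"
  shows "rsum R A (\<lambda>a. u \<otimes> f a) = Some (u \<otimes> v)"
proof -
  have A: "countable A" using f by (rule fsum_countable)
  let ?N = "to_nat_on A ` A" and ?y = "\<lambda>n. f (from_nat_into A n)"
  have y: "rsum R ?N ?y = Some v" using f A by (simp add: fsum_nat) (simp add: fsum_def)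
  have "rsum R {0::nat} (\<lambda>_. u) = Some u" using fsum_singleton[of "\<lambda>_. u"] u by simp
  from sum_mult[OF this y]
  have "rsum R ({0::nat} \<times> ?N) (\<lambda>(a, n). u \<otimes> ?y n) = Some (u \<otimes> v)" .
  moreover have "rsum R A (\<lambda>a. (\<lambda>(a, n). u \<otimes> ?y n) (0::nat, to_nat_on A a)) =
      rsum R ({0::nat} \<times> ?N) (\<lambda>(a, n). u \<otimes> ?y n)"
  proof (rule fsum_reindex[OF A, where f = "\<lambda>a. (0::nat, to_nat_on A a)"
        and y = "\<lambda>(a, n). u \<otimes> ?y n"])
    show "bij_betw (\<lambda>a. (0::nat, to_nat_on A a)) A ({0} \<times> ?N)"
      using inj_on_to_nat_on[OF A] by (auto simp: bij_betw_def inj_on_def)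
  qed
  moreover have "rsum R A (\<lambda>a. (\<lambda>(a, n). u \<otimes> ?y n) (0::nat, to_nat_on A a)) =
      rsum R A (\<lambda>a. u \<otimes> f a)"
    using A by (intro fsum_cong) simp
  ultimately show ?thesis by simp
qed

text \<open>Scaling by the inverse of \<open>u\<close> recovers the original family. This is how the
  coverings yield definedness of sums.\<close>

lemma rsum_cancel:
  assumes u: "u \<in> Units R" and f: "\<And>a. a \<in> A \<Longrightarrow> f a \<in> carrier R"
    and sum: "rsum R A (\<lambda>a. u \<otimes> f a) = Some v"
  shows "\<exists>w\<in>carrier R. rsum R A f = Some w"
proof -
  have "rsum R A (\<lambda>a. inv u \<otimes> (u \<otimes> f a)) = Some (inv u \<otimes> v)"
    using u sum by (intro rsum_cmult) auto
  moreover have "rsum R A (\<lambda>a. inv u \<otimes> (u \<otimes> f a)) = rsum R A f"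
    using u f by (intro fsum_cong) (simp add: m_assoc[symmetric] Units_closed)
  ultimately have "rsum R A f = Some (inv u \<otimes> v)" by simp
  then show ?thesis using fsum_closed by blast
qed

lemma psum_empty: "psum R Map.empty = Some (pzero R)"
  using sum_empty by (auto simp: pzero_def)

lemma pzero_closed: "pzero R \<in> carrier R"
  using sum_empty by (auto simp: pzero_def)

text \<open>Zero is the empty sum, and scaling the empty family leaves it empty.\<close>

lemma mult_pzero:
  assumes "u \<in> carrier R"
  shows "u \<otimes> pzero R = pzero R"
  using rsum_cmult[OF assms, of "{} :: nat set" undefined "pzero R"] psum_empty
  by (simp add: fsum_def)

lemma pzero_mult: "u \<in> carrier R \<Longrightarrow> pzero R \<otimes> u = pzero R"
  using mult_pzero m_comm pzero_closed by simp

lemma rsum_delta: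
  assumes "countable A" "a \<in> A" "v \<in> carrier R"
  shows "rsum R A (\<lambda>b. if b = a then v else pzero R) = Some v"
  unfolding pzero_def using assms by (rule fsum_delta)

lemma sprod_comm:
  assumes "x \<in> vectors R W" "y \<in> vectors R W"
  shows "sprod R W x y = sprod R W y x"
  unfolding sprod_def by (rule fsum_cong) (use assms in \<open>auto intro!: m_comm\<close>)

lemma orth_comm:
  assumes "x \<in> vectors R W" "y \<in> vectors R W"
  shows "orth R B W x y \<longleftrightarrow> orth R B W y x"
  using sprod_comm[OF assms] by (simp add: orth_def)

text \<open>Orthogonality is symmetric on vectors, so \<open>perp\<close> forms an antitone Galois
  connection with itself.\<close>

lemma perp_perp_perp:
  assumes "F \<subseteq> vectors R W"
  shows "perp R B W (perp R B W (perp R B W F)) = perp R B W F"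
proof
  have le: "G \<subseteq> perp R B W (perp R B W G)" if "G \<subseteq> vectors R W" for G
    using that orth_comm[where W = W and B = B] unfolding perp_def by blast
  show "perp R B W F \<subseteq> perp R B W (perp R B W (perp R B W F))"
    by (rule le) (auto simp: perp_def)
  show "perp R B W (perp R B W (perp R B W F)) \<subseteq> perp R B W F"
    using le[OF assms] unfolding perp_def by blast
qed


section \<open>Matrices between spaces\<close>

text \<open>The space of matrices is a triple orthogonal of elementary tensors, which collapses to a
  single one. Membership therefore only has to be tested on tensors of \<open>x\<close> and
  \<open>y\<close>.\<close>

lemma lolli_iff:
  assumes X: "is_space R B X" and Y: "is_space R B Y"
  shows "s \<in> vecs (lolli R B X Y) \<longleftrightarrow> s \<in> vectors R (web X \<times> web Y) \<and>
    (\<forall>x\<in>vecs X. \<forall>y\<in>perp R B (web Y) (vecs Y). \<exists>v\<in>B.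
      rsum R (web X \<times> web Y) (\<lambda>(a, b). x a \<otimes> y b \<otimes> s (a, b)) = Some v)"
proof -
  let ?W = "web X \<times> web Y"
  let ?F = "{tensor_vec R (web X) (web Y) x y | x y.
    x \<in> vecs X \<and> y \<in> perp R B (web Y) (vecs Y)}"
  have "?F \<subseteq> vectors R ?W"
  proof
    fix z assume "z \<in> ?F"
    then obtain x y where z: "z = tensor_vec R (web X) (web Y) x y"
      and "x \<in> vectors R (web X)" "y \<in> vectors R (web Y)"
      using X by (auto simp: is_space_def perp_def)
    then have "x a \<in> carrier R" "y b \<in> carrier R" if "a \<in> web X" "b \<in> web Y" for a b
      using that by auto
    then show "z \<in> vectors R ?W" unfolding z tensor_vec_def by auto
  qed
  \<comment> \<open>Two of the three orthogonals come from \<open>tensor\<close>, the third from the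
    outer \<open>dual\<close>.\<close>
  then have "vecs (lolli R B X Y) = perp R B ?W ?F"
    using perp_perp_perp by (simp add: lolli_def dual_def tensor_def Let_def)
  then have "s \<in> vecs (lolli R B X Y) \<longleftrightarrow>
      s \<in> vectors R ?W \<and> (\<forall>z\<in>?F. orth R B ?W z s)"
    unfolding perp_def[where F = ?F] by simp
  also have "(\<forall>z\<in>?F. orth R B ?W z s) \<longleftrightarrow> (\<forall>x\<in>vecs X. \<forall>y\<in>perp R B (web Y) (vecs Y).
      orth R B ?W (tensor_vec R (web X) (web Y) x y) s)"
    by blast
  finally have iff: "s \<in> vecs (lolli R B X Y) \<longleftrightarrow> s \<in> vectors R ?W \<and>
      (\<forall>x\<in>vecs X. \<forall>y\<in>perp R B (web Y) (vecs Y).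
        orth R B ?W (tensor_vec R (web X) (web Y) x y) s)" .
  have "sprod R ?W (tensor_vec R (web X) (web Y) x y) s =
      rsum R ?W (\<lambda>(a, b). x a \<otimes> y b \<otimes> s (a, b))" for x y
    unfolding sprod_def by (rule fsum_cong) (auto simp: tensor_vec_def)
  then show ?thesis unfolding iff orth_def by simp
qed

lemma mat_mult_Some:
  assumes u: "u \<in> vectors R (W \<times> U)"
    and entry: "\<And>a c. a \<in> W \<Longrightarrow> c \<in> U \<Longrightarrow>
      rsum R V (\<lambda>b. s (a, b) \<otimes> t (b, c)) = Some (u (a, c))"
  shows "mat_mult R W V U t s = Some u"
proof -
  have "restrict (\<lambda>p. the ((\<lambda>(a, c). rsum R V (\<lambda>b. s (a, b) \<otimes> t (b, c))) p)) (W \<times> U) = u"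
    by (rule extensionalityI[where A = "W \<times> U"]) (use u entry in \<open>auto simp: PiE_def\<close>)
  moreover have "\<forall>p\<in>W \<times> U. (\<lambda>(a, c). rsum R V (\<lambda>b. s (a, b) \<otimes> t (b, c))) p \<noteq> None"
    using entry by auto
  ultimately show ?thesis by (auto simp: mat_mult_def Let_def)
qed

lemma mat_mult_entry:
  assumes "mat_mult R W V U t s = Some u" "a \<in> W" "c \<in> U"
  shows "rsum R V (\<lambda>b. s (a, b) \<otimes> t (b, c)) = Some (u (a, c))"
  using assms by (auto simp: mat_mult_def Let_def split: if_splits)

end

section \<open>Application, composition and identity of matrices\<close>

context strong_pcr
begin

text \<open>Summing first over \<open>web X\<close> turns the double sum into the pairing of
  \<open>s \<cdot> x\<close> with \<open>y\<close>. Its entries exist by cancellation, and the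
  pairings put it in the biorthogonal of \<open>vecs Y\<close>, which is \<open>vecs Y\<close>
  itself.\<close>

lemma lolli_apply:
  assumes X: "is_space R B X" and Y: "is_space R B Y"
    and s: "s \<in> vecs (lolli R B X Y)" and x: "x \<in> vecs X"
  obtains y where "y \<in> vecs Y"
    and "\<And>b. b \<in> web Y \<Longrightarrow> rsum R (web X) (\<lambda>a. x a \<otimes> s (a, b)) = Some (y b)"
proof -
  have cX: "countable (web X)" and cY: "countable (web Y)"
    using X Y by (auto simp: is_space_def)
  have sc: "s (a, b) \<in> carrier R" if "a \<in> web X" "b \<in> web Y" for a b
    using s that lolli_iff[OF X Y] by auto
  have xc: "x a \<in> carrier R" if "a \<in> web X" for a
    using X x that by (auto simp: is_space_def)
  \<comment> \<open>This is used twice: a \<open>y\<close> invertible at \<open>b\<close> gives the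
    entry at \<open>b\<close>, and an arbitrary \<open>y\<close> gives orthogonality.\<close>
  have columns: "\<exists>v\<in>B. \<exists>g. rsum R (web Y) g = Some v \<and> (\<forall>b\<in>web Y.
      rsum R (web X) (\<lambda>a. y b \<otimes> (x a \<otimes> s (a, b))) = Some (g b))"
    if y: "y \<in> perp R B (web Y) (vecs Y)" for y
  proof -
    have yc: "y b \<in> carrier R" if "b \<in> web Y" for b
      using y that by (auto simp: perp_def)
    obtain v where v: "v \<in> B"
      "rsum R (web X \<times> web Y) (\<lambda>(a, b). x a \<otimes> y b \<otimes> s (a, b)) = Some v"
      using s x y lolli_iff[OF X Y] by blast
    have "rsum R (web Y \<times> web X) (\<lambda>p. (\<lambda>(a, b). x a \<otimes> y b \<otimes> s (a, b)) (prod.swap p)) = Some v"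
      using cX cY v(2) by (subst fsum_reindex[OF _ bij_betw_swap]) auto
    from fsum_SigmaD[OF cY cX this] obtain g
      where g: "\<And>b. b \<in> web Y \<Longrightarrow> rsum R (web X) (\<lambda>a. x a \<otimes> y b \<otimes> s (a, b)) = Some (g b)"
        and sum: "rsum R (web Y) g = Some v"
      by auto
    have "rsum R (web X) (\<lambda>a. y b \<otimes> (x a \<otimes> s (a, b))) = Some (g b)" if b: "b \<in> web Y" for b
      unfolding g[OF b, symmetric]
      by (rule fsum_cong) (simp add: b xc yc sc m_ac)
    with v(1) sum show ?thesis by blast
  qed
  have "\<exists>w\<in>carrier R. rsum R (web X) (\<lambda>a. x a \<otimes> s (a, b)) = Some w" if b: "b \<in> web Y" for b
  proof -
    obtain y where y: "y \<in> perp R B (web Y) (vecs Y)" "y b \<in> Units R"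
      using Y b unfolding is_space_def covering_def by blast
    then obtain w where w: "rsum R (web X) (\<lambda>a. y b \<otimes> (x a \<otimes> s (a, b))) = Some w"
      using columns b by blast
    show ?thesis by (rule rsum_cancel[OF y(2) _ w]) (simp add: xc sc b)
  qed
  then obtain h where h: "\<And>b. b \<in> web Y \<Longrightarrow> h b \<in> carrier R"
    "\<And>b. b \<in> web Y \<Longrightarrow> rsum R (web X) (\<lambda>a. x a \<otimes> s (a, b)) = Some (h b)"
    by metis
  let ?h = "restrict h (web Y)"
  have "orth R B (web Y) y ?h" if y: "y \<in> perp R B (web Y) (vecs Y)" for y
  proof -
    have yc: "y b \<in> carrier R" if "b \<in> web Y" for b
      using y that by (auto simp: perp_def)
    obtain v g where v: "v \<in> B" and sum: "rsum R (web Y) g = Some v"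
      and g: "\<And>b. b \<in> web Y \<Longrightarrow> rsum R (web X) (\<lambda>a. y b \<otimes> (x a \<otimes> s (a, b))) = Some (g b)"
      using columns[OF y] by blast
    \<comment> \<open>\<open>h\<close> does not depend on \<open>y\<close>; since sums are
      single-valued, the column sums \<open>g b\<close> obtained for each \<open>y\<close> must be
      the scaled entries.\<close>
    have "g b = y b \<otimes> h b" if b: "b \<in> web Y" for b
      using g[OF b] rsum_cmult[OF yc[OF b] h(2)[OF b]] by simp
    then have "rsum R (web Y) g = sprod R (web Y) y ?h"
      unfolding sprod_def by (intro fsum_cong) simp
    with v sum show ?thesis by (auto simp: orth_def)
  qed
  then have "?h \<in> perp R B (web Y) (perp R B (web Y) (vecs Y))"
    using h(1) by (auto simp: perp_def)
  then have "?h \<in> vecs Y" using Y by (simp add: is_space_def)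
  with h(2) show thesis by (intro that[of ?h]) auto
qed

text \<open>The value \<open>v\<close> is the pairing of \<open>t \<cdot> (s \<cdot> x)\<close> with
  \<open>z\<close>. Flattening this iterated sum and regrouping it by pairs \<open>(a, c)\<close>
  exposes the entries of \<open>t \<cdot> s\<close>, scaled by \<open>x a \<otimes> z c\<close>,
  before these entries are known to exist.\<close>

lemma lolli_triple_sum:
  assumes X: "is_space R B X" and Y: "is_space R B Y" and Z: "is_space R B Z"
    and s: "s \<in> vecs (lolli R B X Y)" and t: "t \<in> vecs (lolli R B Y Z)"
    and x: "x \<in> vecs X" and z: "z \<in> perp R B (web Z) (vecs Z)"
  shows "\<exists>v\<in>B. \<exists>k. rsum R (web X \<times> web Z) k = Some v \<and> (\<forall>a\<in>web X. \<forall>c\<in>web Z.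
    rsum R (web Y) (\<lambda>b. (x a \<otimes> z c) \<otimes> (s (a, b) \<otimes> t (b, c))) = Some (k (a, c)))"
proof -
  have cX: "countable (web X)" and cY: "countable (web Y)" and cZ: "countable (web Z)"
    using X Y Z by (auto simp: is_space_def)
  have sc: "s (a, b) \<in> carrier R" if "a \<in> web X" "b \<in> web Y" for a b
    using s that lolli_iff[OF X Y] by auto
  have tc: "t (b, c) \<in> carrier R" if "b \<in> web Y" "c \<in> web Z" for b c
    using t that lolli_iff[OF Y Z] by auto
  have xc: "x a \<in> carrier R" if "a \<in> web X" for a
    using X x that by (auto simp: is_space_def)
  have zc: "z c \<in> carrier R" if "c \<in> web Z" for c
    using z that by (auto simp: perp_def)
  obtain y where y: "y \<in> vecs Y"
    "\<And>b. b \<in> web Y \<Longrightarrow> rsum R (web X) (\<lambda>a. x a \<otimes> s (a, b)) = Some (y b)"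
    using lolli_apply[OF X Y s x] by blast
  obtain w where w: "w \<in> vecs Z"
    "\<And>c. c \<in> web Z \<Longrightarrow> rsum R (web Y) (\<lambda>b. y b \<otimes> t (b, c)) = Some (w c)"
    using lolli_apply[OF Y Z t y(1)] by blast
  have yc: "y b \<in> carrier R" if "b \<in> web Y" for b
    using fsum_closed[OF y(2)[OF that]] .
  have wc: "w c \<in> carrier R" if "c \<in> web Z" for c
    using fsum_closed[OF w(2)[OF that]] .
  obtain v where v: "v \<in> B" and "sprod R (web Z) w z = Some v"
    using z w(1) by (auto simp: perp_def orth_def)
  then have sum: "rsum R (web Z) (\<lambda>c. w c \<otimes> z c) = Some v" by (simp add: sprod_def)
  \<comment> \<open>The bracketing of the index makes the fibre over \<open>(a, c)\<close> the
    family that defines one entry of the product.\<close>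
  define f where "f = (\<lambda>((a, c), b). (x a \<otimes> z c) \<otimes> (s (a, b) \<otimes> t (b, c)))"
  \<comment> \<open>The nesting \<open>c\<close>, \<open>b\<close>, \<open>a\<close> follows the
    order of evaluation of the pairing, so \<open>fsum_SigmaI\<close> applies at both
    levels.\<close>
  have "rsum R (web Z \<times> (web Y \<times> web X)) (\<lambda>(c, b, a). f ((a, c), b)) = Some v"
  proof (rule fsum_SigmaI[OF cZ _ sum])
    fix c assume c: "c \<in> web Z"
    have "rsum R (web Y \<times> web X) (\<lambda>(b, a). f ((a, c), b)) = Some (w c \<otimes> z c)"
    proof (rule fsum_SigmaI[OF cY])
      have "rsum R (web Y) (\<lambda>b. z c \<otimes> (y b \<otimes> t (b, c))) = Some (z c \<otimes> w c)"
        using rsum_cmult[OF zc[OF c] w(2)[OF c]] .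
      then show "rsum R (web Y) (\<lambda>b. z c \<otimes> (y b \<otimes> t (b, c))) = Some (w c \<otimes> z c)"
        using m_comm[OF zc[OF c] wc[OF c]] by simp
    next
      fix b assume b: "b \<in> web Y"
      have "rsum R (web X) (\<lambda>a. (z c \<otimes> t (b, c)) \<otimes> (x a \<otimes> s (a, b))) =
          Some ((z c \<otimes> t (b, c)) \<otimes> y b)"
        using zc[OF c] tc[OF b c] by (intro rsum_cmult y(2)[OF b]) simp
      moreover have "rsum R (web X) (\<lambda>a. (z c \<otimes> t (b, c)) \<otimes> (x a \<otimes> s (a, b))) =
          rsum R (web X) (\<lambda>a. f ((a, c), b))"
        unfolding f_def by (rule fsum_cong) (simp add: b c xc zc sc tc m_ac)
      moreover have "(z c \<otimes> t (b, c)) \<otimes> y b = z c \<otimes> (y b \<otimes> t (b, c))"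
        using zc[OF c] tc[OF b c] yc[OF b] by (simp add: m_ac)
      ultimately show "rsum R (web X) (\<lambda>a. case (b, a) of (b, a) \<Rightarrow> f ((a, c), b)) =
          Some (z c \<otimes> (y b \<otimes> t (b, c)))" by simp
    qed
    then show "rsum R (web Y \<times> web X) (\<lambda>p. case (c, p) of (c, b, a) \<Rightarrow> f ((a, c), b)) =
        Some (w c \<otimes> z c)" by simp
  qed
  moreover have "rsum R (web Z \<times> (web Y \<times> web X)) (\<lambda>p. f ((\<lambda>(c, b, a). ((a, c), b)) p)) =
      rsum R ((web X \<times> web Z) \<times> web Y) f"
    using cX cY cZ by (intro fsum_reindex) (auto simp: bij_betw_def inj_on_def image_iff)
  ultimately have "rsum R ((web X \<times> web Z) \<times> web Y) f = Some v"
    by (simp add: case_prod_unfold)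
  \<comment> \<open>After reindexing, the same sum is split with \<open>(a, c)\<close> outside and
    \<open>b\<close> inside.\<close>
  from fsum_SigmaD[OF _ cY this] cX cZ obtain k
    where "\<And>p. p \<in> web X \<times> web Z \<Longrightarrow> rsum R (web Y) (\<lambda>b. f (p, b)) = Some (k p)"
      and "rsum R (web X \<times> web Z) k = Some v"
    by auto
  with v show ?thesis by (fastforce simp: f_def)
qed

text \<open>The triple sum serves twice. With \<open>x\<close> and \<open>z\<close> invertible at
  the chosen places it gives the entries; with arbitrary \<open>x\<close> and \<open>z\<close> it
  gives the membership test of \<open>lolli_iff\<close>, its inner sums now being the scaled
  entries.\<close>

lemma lolli_comp:
  assumes X: "is_space R B X" and Y: "is_space R B Y" and Z: "is_space R B Z"
    and s: "s \<in> vecs (lolli R B X Y)" and t: "t \<in> vecs (lolli R B Y Z)"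
  shows "\<exists>u\<in>vecs (lolli R B X Z). mat_mult R (web X) (web Y) (web Z) t s = Some u"
proof -
  have sc: "s (a, b) \<in> carrier R" if "a \<in> web X" "b \<in> web Y" for a b
    using s that lolli_iff[OF X Y] by auto
  have tc: "t (b, c) \<in> carrier R" if "b \<in> web Y" "c \<in> web Z" for b c
    using t that lolli_iff[OF Y Z] by auto
  define m where "m a c = the (rsum R (web Y) (\<lambda>b. s (a, b) \<otimes> t (b, c)))" for a c
  have m: "rsum R (web Y) (\<lambda>b. s (a, b) \<otimes> t (b, c)) = Some (m a c)"
    if a: "a \<in> web X" and c: "c \<in> web Z" for a c
  proof -
    obtain x where x: "x \<in> vecs X" "x a \<in> Units R"
      using X a unfolding is_space_def covering_def by blast
    obtain z where z: "z \<in> perp R B (web Z) (vecs Z)" "z c \<in> Units R"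
      using Z c unfolding is_space_def covering_def by blast
    obtain w where "rsum R (web Y) (\<lambda>b. (x a \<otimes> z c) \<otimes> (s (a, b) \<otimes> t (b, c))) = Some w"
      using lolli_triple_sum[OF X Y Z s t x(1) z(1)] a c by blast
    \<comment> \<open>The factor \<open>x a \<otimes> z c\<close> is a product of units, hence a
      unit, and can be cancelled in one go.\<close>
    then have "\<exists>w\<in>carrier R. rsum R (web Y) (\<lambda>b. s (a, b) \<otimes> t (b, c)) = Some w"
      using x(2) z(2) sc tc a c by (intro rsum_cancel) auto
    then show ?thesis by (auto simp: m_def)
  qed
  have mc: "m a c \<in> carrier R" if "a \<in> web X" "c \<in> web Z" for a c
    using fsum_closed[OF m[OF that]] .
  let ?u = "restrict (\<lambda>(a, c). m a c) (web X \<times> web Z)"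
  have u: "?u \<in> vectors R (web X \<times> web Z)" using mc by auto
  have "\<exists>v\<in>B. rsum R (web X \<times> web Z) (\<lambda>(a, c). x a \<otimes> z c \<otimes> ?u (a, c)) = Some v"
    if x: "x \<in> vecs X" and z: "z \<in> perp R B (web Z) (vecs Z)" for x z
  proof -
    obtain v k where v: "v \<in> B" "rsum R (web X \<times> web Z) k = Some v"
      and k: "\<And>a c. a \<in> web X \<Longrightarrow> c \<in> web Z \<Longrightarrow>
        rsum R (web Y) (\<lambda>b. (x a \<otimes> z c) \<otimes> (s (a, b) \<otimes> t (b, c))) = Some (k (a, c))"
      using lolli_triple_sum[OF X Y Z s t x z] by blast
    have "k (a, c) = x a \<otimes> z c \<otimes> m a c" if a: "a \<in> web X" and c: "c \<in> web Z" for a c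
    proof -
      have "x \<in> vectors R (web X)" "z \<in> vectors R (web Z)"
        using X x z by (auto simp: is_space_def perp_def)
      then have "x a \<otimes> z c \<in> carrier R" using a c by auto
      from rsum_cmult[OF this m[OF a c]] k[OF a c] show ?thesis by simp
    qed
    then have "rsum R (web X \<times> web Z) k =
        rsum R (web X \<times> web Z) (\<lambda>(a, c). x a \<otimes> z c \<otimes> ?u (a, c))"
      by (intro fsum_cong) auto
    with v show ?thesis by auto
  qed
  with u have "?u \<in> vecs (lolli R B X Z)" using lolli_iff[OF X Z] by blast
  moreover have "mat_mult R (web X) (web Y) (web Z) t s = Some ?u"
    using u m by (intro mat_mult_Some) auto
  ultimately show ?thesis by blast
qed

text \<open>Tested against \<open>x\<close> and \<open>y\<close>, the identity matrix leaves only
  the diagonal, so the double sum is the scalar product of \<open>x\<close> and \<open>y\<close>,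
  which lies in \<open>B\<close>.\<close>

lemma id_mat_in_lolli:
  assumes X: "is_space R B X"
  shows "id_mat R (web X) \<in> vecs (lolli R B X X)"
proof -
  have cX: "countable (web X)" using X by (simp add: is_space_def)
  have "\<exists>v\<in>B. rsum R (web X \<times> web X) (\<lambda>(a, b). x a \<otimes> y b \<otimes> id_mat R (web X) (a, b)) = Some v"
    if x: "x \<in> vecs X" and y: "y \<in> perp R B (web X) (vecs X)" for x y
  proof -
    have xc: "x a \<in> carrier R" if "a \<in> web X" for a
      using X x that by (auto simp: is_space_def)
    have yc: "y a \<in> carrier R" if "a \<in> web X" for a
      using y that by (auto simp: perp_def)
    obtain v where v: "v \<in> B" "rsum R (web X) (\<lambda>a. x a \<otimes> y a) = Some v"
      using x y by (auto simp: perp_def orth_def sprod_def)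
    have "rsum R (web X \<times> web X) (\<lambda>(a, b). x a \<otimes> y b \<otimes> id_mat R (web X) (a, b)) = Some v"
    proof (rule fsum_SigmaI[OF cX _ v(2)])
      fix a assume a: "a \<in> web X"
      \<comment> \<open>In row \<open>a\<close> every term off the diagonal is zero, so the row sums
        to \<open>x a \<otimes> y a\<close>.\<close>
      have "rsum R (web X) (\<lambda>b. if b = a then x a \<otimes> y a else pzero R) = Some (x a \<otimes> y a)"
        using a xc yc cX by (intro rsum_delta) auto
      moreover have "rsum R (web X) (\<lambda>b. if b = a then x a \<otimes> y a else pzero R) =
          rsum R (web X) (\<lambda>b. x a \<otimes> y b \<otimes> id_mat R (web X) (a, b))"
        using a xc yc by (intro fsum_cong) (auto simp: id_mat_def mult_pzero)
      ultimately show "rsum R (web X)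
          (\<lambda>b. case (a, b) of (a, b) \<Rightarrow> x a \<otimes> y b \<otimes> id_mat R (web X) (a, b)) =
          Some (x a \<otimes> y a)" by simp
    qed
    with v(1) show ?thesis by blast
  qed
  moreover have "id_mat R (web X) \<in> vectors R (web X \<times> web X)"
    using pzero_closed by (auto simp: id_mat_def)
  ultimately show ?thesis using lolli_iff[OF X X] by blast
qed

section \<open>Unit and associativity laws, and the category of spaces\<close>

lemma mat_mult_id:
  assumes f: "f \<in> vectors R (W \<times> V)" and W: "countable W"
  shows "mat_mult R W W V f (id_mat R W) = Some f"
proof (rule mat_mult_Some[OF f])
  fix a c assume ac: "a \<in> W" "c \<in> V"
  have fc: "f (b, c) \<in> carrier R" if "b \<in> W" for b using f ac that by auto
  have "rsum R W (\<lambda>b. id_mat R W (a, b) \<otimes> f (b, c)) =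
      rsum R W (\<lambda>b. if b = a then f (a, c) else pzero R)"
    using ac fc by (intro fsum_cong) (auto simp: id_mat_def pzero_mult)
  also have "\<dots> = Some (f (a, c))" using W ac fc by (intro rsum_delta) auto
  finally show "rsum R W (\<lambda>b. id_mat R W (a, b) \<otimes> f (b, c)) = Some (f (a, c))" .
qed

lemma id_mat_mult:
  assumes f: "f \<in> vectors R (W \<times> V)" and V: "countable V"
  shows "mat_mult R W V V (id_mat R V) f = Some f"
proof (rule mat_mult_Some[OF f])
  fix a c assume ac: "a \<in> W" "c \<in> V"
  have fc: "f (a, b) \<in> carrier R" if "b \<in> V" for b using f ac that by auto
  have "rsum R V (\<lambda>b. f (a, b) \<otimes> id_mat R V (b, c)) =
      rsum R V (\<lambda>b. if b = c then f (a, c) else pzero R)"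
    using ac fc by (intro fsum_cong) (auto simp: id_mat_def mult_pzero)
  also have "\<dots> = Some (f (a, c))" using V ac fc by (intro rsum_delta) auto
  finally show "rsum R V (\<lambda>b. f (a, b) \<otimes> id_mat R V (b, c)) = Some (f (a, c))" .
qed

text \<open>Both composites are iterated sums of the products of entries of \<open>f\<close>,
  \<open>g\<close> and \<open>h\<close>. PA flattens the sum that defines \<open>r\<close> into one
  over \<open>U \<times> V\<close>; swapping and splitting it by WPA yields the other composite,
  including its definedness.\<close>

lemma mat_mult_assoc:
  assumes cV: "countable V" and cU: "countable U"
    and f: "f \<in> vectors R (W \<times> V)" and g: "g \<in> vectors R (V \<times> U)"
    and h: "h \<in> vectors R (U \<times> T)" and r: "r \<in> vectors R (W \<times> T)"
    and gf: "mat_mult R W V U g f = Some p" and hg: "mat_mult R V U T h g = Some q"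
    and hp: "mat_mult R W U T h p = Some r"
  shows "mat_mult R W V T q f = Some r"
proof (rule mat_mult_Some[OF r])
  fix a d assume a: "a \<in> W" and d: "d \<in> T"
  have fc: "f (a, b) \<in> carrier R" if "b \<in> V" for b using f a that by auto
  have gc: "g (b, c) \<in> carrier R" if "b \<in> V" "c \<in> U" for b c using g that by auto
  have hc: "h (c, d) \<in> carrier R" if "c \<in> U" for c using h d that by auto
  let ?e = "\<lambda>(b, c). f (a, b) \<otimes> (g (b, c) \<otimes> h (c, d))"
  have "rsum R (U \<times> V) (\<lambda>p. ?e (prod.swap p)) = Some (r (a, d))"
  proof (rule fsum_SigmaI[OF cU _ mat_mult_entry[OF hp a d]])
    fix c assume c: "c \<in> U"
    note pc = mat_mult_entry[OF gf a c]
    have "rsum R V (\<lambda>b. ?e (prod.swap (c, b))) =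
        rsum R V (\<lambda>b. h (c, d) \<otimes> (f (a, b) \<otimes> g (b, c)))"
      by (rule fsum_cong) (simp add: c fc gc hc m_ac)
    also have "\<dots> = Some (h (c, d) \<otimes> p (a, c))" by (rule rsum_cmult[OF hc[OF c] pc])
    also have "h (c, d) \<otimes> p (a, c) = p (a, c) \<otimes> h (c, d)"
      by (rule m_comm[OF hc[OF c] fsum_closed[OF pc]])
    finally show "rsum R V (\<lambda>b. ?e (prod.swap (c, b))) = Some (p (a, c) \<otimes> h (c, d))" .
  qed
  moreover have "rsum R (U \<times> V) (\<lambda>p. ?e (prod.swap p)) = rsum R (V \<times> U) ?e"
    using cU cV by (intro fsum_reindex bij_betw_swap) auto
  ultimately have "rsum R (V \<times> U) ?e = Some (r (a, d))" by simp
  from fsum_SigmaD[OF cV cU this] obtain k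
    where k: "\<And>b. b \<in> V \<Longrightarrow>
        rsum R U (\<lambda>c. f (a, b) \<otimes> (g (b, c) \<otimes> h (c, d))) = Some (k b)"
      and sum: "rsum R V k = Some (r (a, d))"
    by auto
  have "k b = f (a, b) \<otimes> q (b, d)" if b: "b \<in> V" for b
    using k[OF b] rsum_cmult[OF fc[OF b] mat_mult_entry[OF hg b d]] by simp
  then have "rsum R V k = rsum R V (\<lambda>b. f (a, b) \<otimes> q (b, d))" by (rule fsum_cong)
  with sum show "rsum R V (\<lambda>b. f (a, b) \<otimes> q (b, d)) = Some (r (a, d))" by simp
qed

text \<open>\<open>category\<close> has one type of objects and one of morphisms, so all webs here
  lie in a common type \<open>'d\<close>. Composition is made total by \<open>the\<close>, which is
  harmless on the hom-sets because \<open>lolli_comp\<close> makes the product defined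
  there.\<close>

lemma category_spaces:
  "category {X :: ('d, 'r) space. is_space R B X}
     (\<lambda>X Y. vecs (lolli R B X Y))
     (\<lambda>X. id_mat R (web X))
     (\<lambda>X Y Z t s. the (mat_mult R (web X) (web Y) (web Z) t s))"
proof -
  have vec: "f \<in> vectors R (web X \<times> web Y)"
    if "is_space R B X" "is_space R B Y" "f \<in> vecs (lolli R B X Y)"
    for X Y :: "('d, 'r) space" and f
    using that lolli_iff by blast
  have web: "countable (web X)" if "is_space R B X" for X :: "('d, 'r) space"
    using that by (simp add: is_space_def)
  show ?thesis
  proof (unfold_locales, unfold mem_Collect_eq)
    fix X :: "('d, 'r) space" assume "is_space R B X"
    then show "id_mat R (web X) \<in> vecs (lolli R B X X)" by (rule id_mat_in_lolli)
  next
    fix X Y Z :: "('d, 'r) space" and f g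
    assume "is_space R B X" "is_space R B Y" "is_space R B Z"
      "f \<in> vecs (lolli R B X Y)" "g \<in> vecs (lolli R B Y Z)"
    then show "the (mat_mult R (web X) (web Y) (web Z) g f) \<in> vecs (lolli R B X Z)"
      using lolli_comp by fastforce
  next
    fix X Y :: "('d, 'r) space" and f
    assume XY: "is_space R B X" "is_space R B Y" "f \<in> vecs (lolli R B X Y)"
    show "the (mat_mult R (web X) (web X) (web Y) f (id_mat R (web X))) = f"
      using mat_mult_id[OF vec[OF XY] web[OF XY(1)]] by simp
    show "the (mat_mult R (web X) (web Y) (web Y) (id_mat R (web Y)) f) = f"
      using id_mat_mult[OF vec[OF XY] web[OF XY(2)]] by simp
  next
    fix W X Y Z :: "('d, 'r) space" and f g h
    assume sp: "is_space R B W" "is_space R B X" "is_space R B Y" "is_space R B Z"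
      and f: "f \<in> vecs (lolli R B W X)" and g: "g \<in> vecs (lolli R B X Y)"
      and h: "h \<in> vecs (lolli R B Y Z)"
    obtain p where p: "p \<in> vecs (lolli R B W Y)"
      "mat_mult R (web W) (web X) (web Y) g f = Some p"
      using lolli_comp[OF sp(1,2,3) f g] by blast
    obtain q where q: "mat_mult R (web X) (web Y) (web Z) h g = Some q"
      using lolli_comp[OF sp(2,3,4) g h] by blast
    \<comment> \<open>Membership of \<open>r\<close> in a hom-set also makes it a vector, as
      \<open>mat_mult_assoc\<close> requires.\<close>
    obtain r where r: "r \<in> vecs (lolli R B W Z)"
      "mat_mult R (web W) (web Y) (web Z) h p = Some r"
      using lolli_comp[OF sp(1,3,4) p(1) h] by blast
    have "mat_mult R (web W) (web X) (web Z) q f = Some r"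
      by (rule mat_mult_assoc[OF web[OF sp(2)] web[OF sp(3)] vec[OF sp(1,2) f]
          vec[OF sp(2,3) g] vec[OF sp(3,4) h] vec[OF sp(1,4) r(1)] p(2) q r(2)])
    with p(2) q r(2) show "the (mat_mult R (web W) (web Y) (web Z) h
          (the (mat_mult R (web W) (web X) (web Y) g f))) =
        the (mat_mult R (web W) (web X) (web Z)
          (the (mat_mult R (web X) (web Y) (web Z) h g)) f)"
      by simp
  qed
qed

end

theorem theorem2p6:
  fixes R :: "('r, 'z) pcr_scheme" and B :: "'r set"
  assumes "strong_pcr R"
    and "B \<subseteq> carrier R"
    and "downward_closed R B"
  shows "(\<forall>(X :: ('a, 'r) space) (Y :: ('b, 'r) space) (Z :: ('c, 'r) space).
            is_space R B X \<longrightarrow> is_space R B Y \<longrightarrow> is_space R B Z \<longrightarrow>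
            (\<forall>s \<in> vecs (lolli R B X Y). \<forall>t \<in> vecs (lolli R B Y Z).
               \<exists>u \<in> vecs (lolli R B X Z). mat_mult R (web X) (web Y) (web Z) t s = Some u))
       \<and> (\<forall>X :: ('a, 'r) space. is_space R B X \<longrightarrow>
            id_mat R (web X) \<in> vecs (lolli R B X X))
       \<and> category {X :: ('d, 'r) space. is_space R B X}
           (\<lambda>X Y. vecs (lolli R B X Y))
           (\<lambda>X. id_mat R (web X))
           (\<lambda>X Y Z t s. the (mat_mult R (web X) (web Y) (web Z) t s))"
proof -
  interpret strong_pcr R by fact
  show ?thesis using lolli_comp id_mat_in_lolli category_spaces by blast
qed

end
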